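(* Let $a>0$, $T>0$, let $\rho$ be an arbitrary fixed constant, and let $u=u(x,t)$ be an arbitrary solution of $$u_t=u_{xx}\ \text{ in } ]0,a[\,\times\,]0,T[,\qquad u_x(a,t)+\rho\,u(a,t)=0\ \text{ for } t\in\,]0,T[,\qquad u(x,0)=0\ \text{ in } ]0,a[.$$ Let $M$ be a positive number such that $M\ge 2a$. Let $c$ be an arbitrary positive number satisfying $Mc<T$. Assume that $u_x(0,t)$, $0<t<T$, satisfies the condition $c$ (defined in the context). For $\tau>c^{-2}$ let $$I_c(\tau)=\int_0^T\bigl(-v_x(0,t)u(0,t)+u_x(0,t)v(0,t)\bigr)\,dt,$$ where $v(x,t)=e^{-z^2t}e^{xz}$ and $z=-c\tau\left(1+i\sqrt{1-\frac{1}{c^2\tau}}\right)$. Then $$\lim_{\tau\to\infty}\frac{\log|I_c(\tau)|}{\tau}=-2ca.$$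
   Context: $]\alpha,\beta[$ denotes an open interval. Condition $c$: for $c>0$, a function $f\in L^1(0,T)$ satisfies the condition $c$ if there exist positive constants $C_1,C_2$ and real numbers $\tau_0\,(\ge c^{-2})$, $\mu_1$, $\mu_2$ such that, for all $\tau\ge\tau_0$, $$C_1\tau^{\mu_1}\le\left|\int_0^Tf(t)e^{-z^2t}\,dt\right|\le C_2\tau^{\mu_2},\qquad\text{where } z^2=\tau+i\,2c^2\tau^2\sqrt{1-\frac{1}{c^2\tau}}.$$ (This $z^2$ is the square of the $z$ appearing in the claim.) The paper does not specify a function class for solutions $u$; they are understood to be regular enough that the boundary values $u(0,t)$, $u_x(0,t)$, $u(a,t)$, the final value $u(x,T)$ and integrations by parts make sense. *)

theory Defs
  imports "HOL-Analysis.Analysis"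
begin

text \<open>
  Convergence in \<open>L\<^sup>1(S)\<close> of the family \<open>f p\<close> to \<open>g\<close> along a filter.  Integrability is demanded
  explicitly because the Lebesgue integral of a non-integrable function is 0 by convention.
\<close>

definition L1_tendsto ::
  "(real \<Rightarrow> real \<Rightarrow> complex) \<Rightarrow> (real \<Rightarrow> complex) \<Rightarrow> real set \<Rightarrow> real filter \<Rightarrow> bool" where
  "L1_tendsto f g S F \<longleftrightarrow>
     g absolutely_integrable_on S \<and>
     (\<forall>\<^sub>F p in F. f p absolutely_integrable_on S) \<and>
     ((\<lambda>p. LINT q:S|lebesgue. norm (f p q - g q)) \<longlongrightarrow> 0) F"

text \<open>
  \<open>u\<close> is of class \<open>C\<^sup>2\<close> in \<open>x\<close> and \<open>C\<^sup>1\<close> in \<open>t\<close> inside the open rectangle, \<open>ux\<close> is its \<open>x\<close>-derivative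
  there, and \<open>u\<^sub>t = u\<^sub>x\<^sub>x\<close> holds pointwise.
\<close>

definition heat_equation_on ::
  "real \<Rightarrow> real \<Rightarrow> (real \<Rightarrow> real \<Rightarrow> complex) \<Rightarrow> (real \<Rightarrow> real \<Rightarrow> complex) \<Rightarrow> bool" where
  "heat_equation_on a T u ux \<longleftrightarrow>
     (\<exists>ut uxx.
        (\<forall>w\<in>{u, ux, ut, uxx}. continuous_on ({0<..<a} \<times> {0<..<T}) (\<lambda>(x, t). w x t)) \<and>
        (\<forall>x\<in>{0<..<a}. \<forall>t\<in>{0<..<T}.
           ((\<lambda>t. u x t) has_vector_derivative ut x t) (at t) \<and>
           ((\<lambda>x. u x t) has_vector_derivative ux x t) (at x) \<and>
           ((\<lambda>x. ux x t) has_vector_derivative uxx x t) (at x) \<and>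
           ut x t = uxx x t))"

text \<open>
  The values of \<open>u\<close> and \<open>ux\<close> on the sides \<open>x = 0\<close> and \<open>x = a\<close> are the traces from the interior, in
  the sense of \<open>L\<^sup>1\<close> on compact time intervals inside \<open>]0,T[\<close>; the traces of \<open>u\<close> are integrable up to
  \<open>t = 0\<close> and \<open>t = T\<close>.  (Integrability of \<open>ux 0\<close> on the whole of \<open>]0,T[\<close> is part of
  \<open>condition_c\<close> below; that of \<open>ux a\<close> follows from the Robin condition.)  The values of \<open>u\<close> at
  \<open>t = 0\<close> and \<open>t = T\<close> are limits in \<open>L\<^sup>1(0,a)\<close>.  This is what integration by parts over the rectangle
  requires.  No compatibility of the data at the corners and no continuity of the flux
  \<open>u\<^sub>x(0,\<cdot>)\<close> is assumed.
\<close>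

definition has_boundary_values ::
  "real \<Rightarrow> real \<Rightarrow> (real \<Rightarrow> real \<Rightarrow> complex) \<Rightarrow> (real \<Rightarrow> real \<Rightarrow> complex) \<Rightarrow> bool" where
  "has_boundary_values a T u ux \<longleftrightarrow>
     (\<forall>r s. 0 < r \<and> r < s \<and> s < T \<longrightarrow>
        L1_tendsto u (u 0) {r..s} (at_right 0) \<and>
        L1_tendsto ux (ux 0) {r..s} (at_right 0) \<and>
        L1_tendsto u (u a) {r..s} (at_left a) \<and>
        L1_tendsto ux (ux a) {r..s} (at_left a)) \<and>
     u 0 absolutely_integrable_on {0<..<T} \<and>
     u a absolutely_integrable_on {0<..<T} \<and>
     L1_tendsto (\<lambda>t x. u x t) (\<lambda>x. u x 0) {0<..<a} (at_right 0) \<and>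
     L1_tendsto (\<lambda>t x. u x t) (\<lambda>x. u x T) {0<..<a} (at_left T)"

definition heat_robin_solution ::
  "real \<Rightarrow> real \<Rightarrow> complex \<Rightarrow> (real \<Rightarrow> real \<Rightarrow> complex) \<Rightarrow> (real \<Rightarrow> real \<Rightarrow> complex) \<Rightarrow> bool" where
  "heat_robin_solution a T \<rho> u ux \<longleftrightarrow>
     heat_equation_on a T u ux \<and>
     has_boundary_values a T u ux \<and>
     (\<forall>t\<in>{0<..<T}. ux a t + \<rho> * u a t = 0) \<and>
     (\<forall>x\<in>{0<..<a}. u x 0 = 0)"

definition zeta :: "real \<Rightarrow> real \<Rightarrow> complex" where
  "zeta c \<tau> = - (of_real (c * \<tau>) * (1 + \<i> * of_real (sqrt (1 - 1 / (c\<^sup>2 * \<tau>)))))"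

definition condition_c :: "real \<Rightarrow> real \<Rightarrow> (real \<Rightarrow> complex) \<Rightarrow> bool" where
  "condition_c c T f \<longleftrightarrow>
     f absolutely_integrable_on {0<..<T} \<and>
     (\<exists>C1 C2 \<tau>0 \<mu>1 \<mu>2 :: real.
        C1 > 0 \<and> C2 > 0 \<and> \<tau>0 \<ge> 1 / c\<^sup>2 \<and>
        (\<forall>\<tau>\<ge>\<tau>0.
           C1 * \<tau> powr \<mu>1 \<le> norm (LINT t:{0<..<T}|lebesgue. f t * exp (- (zeta c \<tau>)\<^sup>2 * of_real t)) \<and>
           norm (LINT t:{0<..<T}|lebesgue. f t * exp (- (zeta c \<tau>)\<^sup>2 * of_real t)) \<le> C2 * \<tau> powr \<mu>2))"

lemma zeta_squared:
  assumes "c > 0" "\<tau> \<ge> 1 / c\<^sup>2"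
  shows "(zeta c \<tau>)\<^sup>2 = of_real \<tau> + \<i> * of_real (2 * c\<^sup>2 * \<tau>\<^sup>2 * sqrt (1 - 1 / (c\<^sup>2 * \<tau>)))"
proof -
  have tau: "\<tau> > 0"
    using assms by (smt (verit) divide_pos_pos zero_less_power)
  have "1 / (c\<^sup>2 * \<tau>) \<le> 1"
    using assms tau by (simp add: field_simps)
  then have sq: "(sqrt (1 - 1 / (c\<^sup>2 * \<tau>)))\<^sup>2 = 1 - 1 / (c\<^sup>2 * \<tau>)"
    by simp
  define s where "s = sqrt (1 - 1 / (c\<^sup>2 * \<tau>))"
  have "c\<^sup>2 * \<tau>\<^sup>2 * (1 - s\<^sup>2) = \<tau>"
    unfolding s_def sq using assms tau by (simp add: field_simps power2_eq_square)
  then have "c * \<tau> * (c * \<tau>) - c * \<tau> * s * (c * \<tau> * s) = \<tau>"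
    by (simp add: algebra_simps power2_eq_square)
  then show ?thesis
    unfolding zeta_def s_def[symmetric]
    by (simp add: complex_eq_iff power2_eq_square algebra_simps)
qed

definition probe :: "real \<Rightarrow> real \<Rightarrow> real \<Rightarrow> real \<Rightarrow> complex" where
  "probe c \<tau> x t = exp (- (zeta c \<tau>)\<^sup>2 * of_real t) * exp (of_real x * zeta c \<tau>)"

definition indicator_integral ::
  "real \<Rightarrow> real \<Rightarrow> (real \<Rightarrow> real \<Rightarrow> complex) \<Rightarrow> (real \<Rightarrow> real \<Rightarrow> complex) \<Rightarrow> real \<Rightarrow> complex" where
  "indicator_integral c T u ux \<tau> =
     (LINT t:{0<..<T}|lebesgue.
        - vector_derivative (\<lambda>x. probe c \<tau> x t) (at 0) * u 0 t + ux 0 t * probe c \<tau> 0 t)"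

end

theory Submission
  imports Defs "HOL-Real_Asymp.Real_Asymp"
begin

text \<open>
  For \<open>\<kappa> = z\<^sup>2\<close> the Laplace transform \<open>U(x) = \<integral> u(x,t) exp (- \<kappa> t) dt\<close> over \<open>]0,T[\<close> solves
  \<open>U'' - z\<^sup>2 U = exp (- \<kappa> T) u(x,T)\<close> with a Robin condition at \<open>x = a\<close>, and the indicator integral
  is \<open>U'(0) - z U(0)\<close>.  Without the right-hand side, \<open>U\<close> would be a multiple of
  \<open>exp (x z) + K exp (- x z)\<close> with the reflection coefficient
  \<open>K = (z + \<rho>) / (z - \<rho>) exp (2 a z)\<close>.  The combination \<open>U'(0) - z U(0)\<close> annihilates the wave
  \<open>exp (x z)\<close> and sees only its reflection at \<open>x = a\<close>, so it equals \<open>- 2 K U'(0) / (1 - K)\<close>.  Now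
  \<open>Re z = - c \<tau>\<close> gives \<open>|exp (2 a z)| = exp (- 2 a c \<tau>)\<close>, and \<open>(z + \<rho>) / (z - \<rho>)\<close> tends to
  \<open>1\<close>.  The condition on \<open>u\<^sub>x(0,\<cdot>)\<close> bounds \<open>U'(0)\<close> between powers of \<open>\<tau>\<close>, which do not
  affect the exponential rate.  The right-hand side contributes \<open>O(exp (- T \<tau>))\<close> because
  \<open>Re z\<^sup>2 = \<tau>\<close>, and this is negligible because \<open>2 a c \<le> M c < T\<close>.

  The proof does not form \<open>U\<close> for interior \<open>x\<close>, where \<open>u\<close> need not be integrable in \<open>t\<close> up to
  \<open>t = 0\<close> and \<open>t = T\<close>.  Instead it tests the heat equation with \<open>exp (- \<kappa> t) \<phi>(x)\<close>, where \<open>\<phi>\<close> is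
  the reflected wave above: since \<open>\<phi>\<close> satisfies the Robin condition too, Green's identity
  (\<open>lateral_green_identity\<close>) involves only the traces at \<open>x = 0\<close> and the final value, and it turns
  into the formula for the indicator integral in \<open>reflected_identity\<close>.  Green's identity holds
  classically on interior rectangles (\<open>interior_green_identity\<close>) and is carried to the boundary by
  the \<open>L\<^sup>1\<close> convergence of the boundary values.  The limit itself is
  \<open>ln_over_tendsto_exponential_rate\<close>.
\<close>

section \<open>Products of integrable and continuous functions\<close>

lemma absolutely_integrable_times_continuous:
  fixes f h :: "real \<Rightarrow> complex"
  assumes f: "f absolutely_integrable_on S" and S: "S \<in> sets lebesgue" "S \<subseteq> {l..m}"
    and h: "continuous_on {l..m} h"
  shows "(\<lambda>q. f q * h q) absolutely_integrable_on S"
proof -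
  have "h \<in> borel_measurable (lebesgue_on S)"
    using continuous_imp_measurable_on_sets_lebesgue[OF continuous_on_subset[OF h S(2)] S(1)] .
  moreover have "bounded (h ` S)"
    using compact_imp_bounded[OF compact_continuous_image[OF h compact_Icc]] S(2)
    by (meson bounded_subset image_mono)
  ultimately have "(\<lambda>q. h q * f q) absolutely_integrable_on S"
    using absolutely_integrable_bounded_measurable_product[OF bilinear_times _ S(1) _ f] by blast
  then show ?thesis
    by (simp add: mult.commute)
qed

text \<open>
  The error term of the asymptotics is estimated with this bound: the final value of the solution is
  merely integrable, while its weight is continuous with an explicit bound.
\<close>

lemma norm_integral_times_le:
  fixes f h :: "real \<Rightarrow> complex"
  assumes f: "f absolutely_integrable_on S" and S: "S \<in> sets lebesgue" "S \<subseteq> {l..m}"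
    and h: "continuous_on {l..m} h" and B: "\<And>q. q \<in> S \<Longrightarrow> norm (h q) \<le> B"
  shows "norm (integral S (\<lambda>q. f q * h q)) \<le> B * (LINT q:S|lebesgue. norm (f q))"
proof -
  have nf: "(\<lambda>q. norm (f q)) absolutely_integrable_on S"
    using absolutely_integrable_norm[OF f] by (simp add: o_def)
  have "norm (integral S (\<lambda>q. f q * h q)) \<le> integral S (\<lambda>q. B * norm (f q))"
  proof (rule integral_norm_bound_integral)
    show "(\<lambda>q. f q * h q) integrable_on S"
      using absolutely_integrable_times_continuous[OF f S h]
      by (rule set_lebesgue_integral_eq_integral(1))
    show "(\<lambda>q. B * norm (f q)) integrable_on S"
      using set_lebesgue_integral_eq_integral(1)[OF nf] by (rule integrable_on_mult_right)
    show "norm (f q * h q) \<le> B * norm (f q)" if "q \<in> S" for q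
      using mult_right_mono[OF B[OF that] norm_ge_zero] by (simp add: norm_mult mult.commute)
  qed
  also have "\<dots> = B * (LINT q:S|lebesgue. norm (f q))"
    by (simp add: set_lebesgue_integral_eq_integral(2)[OF nf])
  finally show ?thesis .
qed

text \<open>
  A continuous weight on a compact interval is bounded, so \<open>L\<^sup>1\<close> convergence passes to weighted
  integrals.  This carries each term of Green's identity to the boundary.
\<close>

lemma L1_tendsto_integral_times:
  assumes L: "L1_tendsto f g S F" and S: "S \<in> sets lebesgue" "S \<subseteq> {l..m}"
    and h: "continuous_on {l..m} h"
  shows "((\<lambda>p. integral S (\<lambda>q. f p q * h q)) \<longlongrightarrow> integral S (\<lambda>q. g q * h q)) F"
proof -
  have g: "g absolutely_integrable_on S"
    and ev: "\<forall>\<^sub>F p in F. f p absolutely_integrable_on S"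
    and lim: "((\<lambda>p. LINT q:S|lebesgue. norm (f p q - g q)) \<longlongrightarrow> 0) F"
    using L by (auto simp: L1_tendsto_def)
  obtain B where B: "\<And>q. q \<in> {l..m} \<Longrightarrow> norm (h q) \<le> B"
    using compact_imp_bounded[OF compact_continuous_image[OF h compact_Icc]]
    unfolding bounded_iff by blast
  have "((\<lambda>p. integral S (\<lambda>q. f p q * h q) - integral S (\<lambda>q. g q * h q)) \<longlongrightarrow> 0) F"
  proof (rule Lim_null_comparison)
    show "((\<lambda>p. B * (LINT q:S|lebesgue. norm (f p q - g q))) \<longlongrightarrow> 0) F"
      using tendsto_mult_left[OF lim, of B] by simp
    show "\<forall>\<^sub>F p in F. norm (integral S (\<lambda>q. f p q * h q) - integral S (\<lambda>q. g q * h q))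
            \<le> B * (LINT q:S|lebesgue. norm (f p q - g q))"
      using ev
    proof eventually_elim
      case (elim p)
      have "integral S (\<lambda>q. f p q * h q) - integral S (\<lambda>q. g q * h q)
          = integral S (\<lambda>q. (f p q - g q) * h q)"
        using set_lebesgue_integral_eq_integral(1)[OF absolutely_integrable_times_continuous[OF elim S h]]
          set_lebesgue_integral_eq_integral(1)[OF absolutely_integrable_times_continuous[OF g S h]]
        by (simp add: Henstock_Kurzweil_Integration.integral_diff left_diff_distrib)
      then show ?case
        using norm_integral_times_le[OF set_integral_diff(1)[OF elim g] S h B] S(2)
        by (simp add: subset_iff)
    qed
  qed
  then show ?thesis
    by (simp add: LIM_zero_iff)
qed

section \<open>Green's identity for the heat equation\<close>

lemma continuous_on_rectangle_slice:
  assumes "continuous_on (A \<times> B) (\<lambda>(x, t). w x t)"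
  shows "t \<in> B \<Longrightarrow> continuous_on A (\<lambda>x. w x t)" "x \<in> A \<Longrightarrow> continuous_on B (w x)"
proof -
  show "continuous_on A (\<lambda>x. w x t)" if "t \<in> B"
  proof -
    have "continuous_on A (\<lambda>x. (x, t))"
      by (intro continuous_intros)
    from continuous_on_compose2[OF assms this] that show ?thesis
      by auto
  qed
  show "continuous_on B (w x)" if "x \<in> A"
  proof -
    have "continuous_on B (\<lambda>t. (x, t))"
      by (intro continuous_intros)
    from continuous_on_compose2[OF assms this] that show ?thesis
      by auto
  qed
qed

text \<open>
  The weight \<open>w(x,t) = \<phi>(x) \<eta>(t)\<close> solves the adjoint equation \<open>w\<^sub>t + w\<^sub>x\<^sub>x = 0\<close>, so \<open>(u w)\<^sub>t\<close> is the
  \<open>x\<close>-derivative of the flux \<open>u\<^sub>x w - u w\<^sub>x\<close>.  On a closed rectangle inside the domain everything is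
  continuous, so one may differentiate \<open>\<integral> u w dx\<close> under the integral sign, evaluate the derivative
  by the fundamental theorem of calculus in \<open>x\<close>, and apply that theorem once more in \<open>t\<close>.
\<close>

lemma interior_green_identity:
  fixes u ux :: "real \<Rightarrow> real \<Rightarrow> complex" and \<phi> \<phi>' :: "real \<Rightarrow> complex" and \<kappa> :: complex
  assumes heat: "heat_equation_on a T u ux"
    and \<phi>: "\<And>x. (\<phi> has_vector_derivative \<phi>' x) (at x)"
    and \<phi>': "\<And>x. (\<phi>' has_vector_derivative \<kappa> * \<phi> x) (at x)"
    and \<alpha>\<beta>: "0 < \<alpha>" "\<alpha> \<le> \<beta>" "\<beta> < a" and rs: "0 < r" "r \<le> s" "s < T"
  defines "\<eta> \<equiv> \<lambda>t. exp (- \<kappa> * of_real t)"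
  shows "\<eta> s * integral {\<alpha>..\<beta>} (\<lambda>x. u x s * \<phi> x) - \<eta> r * integral {\<alpha>..\<beta>} (\<lambda>x. u x r * \<phi> x)
       = integral {r..s} (\<lambda>t. (ux \<beta> t * \<phi> \<beta> - u \<beta> t * \<phi>' \<beta>) * \<eta> t)
       - integral {r..s} (\<lambda>t. (ux \<alpha> t * \<phi> \<alpha> - u \<alpha> t * \<phi>' \<alpha>) * \<eta> t)"
proof -
  from heat obtain ut uxx where
    cont: "\<forall>w\<in>{u, ux, ut, uxx}. continuous_on ({0<..<a} \<times> {0<..<T}) (\<lambda>(x, t). w x t)"
    and pde: "\<forall>x\<in>{0<..<a}. \<forall>t\<in>{0<..<T}.
           ((\<lambda>t. u x t) has_vector_derivative ut x t) (at t) \<and>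
           ((\<lambda>x. u x t) has_vector_derivative ux x t) (at x) \<and>
           ((\<lambda>x. ux x t) has_vector_derivative uxx x t) (at x) \<and>
           ut x t = uxx x t"
    unfolding heat_equation_on_def by (elim exE conjE)
  note cont = cont[rule_format]
  have ut: "((\<lambda>t. u x t) has_vector_derivative ut x t) (at t)"
    and ux: "((\<lambda>x. u x t) has_vector_derivative ux x t) (at x)"
    and uxx: "((\<lambda>x. ux x t) has_vector_derivative uxx x t) (at x)"
    and eq: "ut x t = uxx x t"
    if "x \<in> {0<..<a}" "t \<in> {0<..<T}" for x t
    using pde that by blast+
  have sub: "{\<alpha>..\<beta>} \<subseteq> {0<..<a}" "{r..s} \<subseteq> {0<..<T}"
    using \<alpha>\<beta> rs by auto
  have cont_\<phi>: "continuous_on X \<phi>" for X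
    using \<phi> by (meson continuous_at_imp_continuous_on has_vector_derivative_continuous)
  have \<eta>': "(\<eta> has_vector_derivative - \<kappa> * \<eta> t) (at t)" for t
  proof -
    have "((\<lambda>w. exp (- \<kappa> * w)) has_field_derivative - \<kappa> * exp (- \<kappa> * of_real t)) (at (of_real t))"
      by (auto intro!: derivative_eq_intros)
    from has_vector_derivative_real_field[OF this] show ?thesis
      unfolding \<eta>_def .
  qed
  have cont_\<eta>: "continuous_on X \<eta>" for X
    unfolding \<eta>_def by (intro continuous_intros)
  have slice: "continuous_on {\<alpha>..\<beta>} (\<lambda>x. u x t)" if "t \<in> {r..s}" for t
    using continuous_on_subset[OF continuous_on_rectangle_slice(1)[OF cont[of u]]] that sub by auto
  define q where "q x t = (ux x t * \<phi> x - u x t * \<phi>' x) * \<eta> t" for x t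
  define J where "J t = integral {\<alpha>..\<beta>} (\<lambda>x. u x t * \<phi> x * \<eta> t)" for t
  define D where "D t x = (ut x t * \<phi> x - \<kappa> * u x t * \<phi> x) * \<eta> t" for x t
  have flux: "integral {\<alpha>..\<beta>} (D t) = q \<beta> t - q \<alpha> t" if t: "t \<in> {r..s}" for t
  proof (rule integral_unique, rule fundamental_theorem_of_calculus[OF \<alpha>\<beta>(2)])
    fix x assume x: "x \<in> {\<alpha>..\<beta>}"
    then have xt: "x \<in> {0<..<a}" "t \<in> {0<..<T}"
      using t sub by auto
    have "((\<lambda>x. q x t) has_vector_derivative D t x) (at x)"
      unfolding q_def D_def
      by (rule derivative_eq_intros ux[OF xt] uxx[OF xt] \<phi> \<phi>' refl)+
        (simp add: eq[OF xt] algebra_simps)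
    then show "((\<lambda>x. q x t) has_vector_derivative D t x) (at x within {\<alpha>..\<beta>})"
      by (rule has_vector_derivative_at_within)
  qed
  have cont_D: "continuous_on ({r..s} \<times> cbox \<alpha> \<beta>) (\<lambda>(t, x). D t x)"
  proof -
    have c: "continuous_on ({r..s} \<times> {\<alpha>..\<beta>}) (\<lambda>p. w (snd p) (fst p))" if "w \<in> {u, ux, ut, uxx}" for w
    proof -
      have "continuous_on ({r..s} \<times> {\<alpha>..\<beta>}) (\<lambda>p. (snd p, fst p))"
        by (intro continuous_intros)
      moreover have "(\<lambda>p. (snd p, fst p)) ` ({r..s} \<times> {\<alpha>..\<beta>}) \<subseteq> {0<..<a} \<times> {0<..<T}"
        using sub by (force simp: subset_iff)
      ultimately show ?thesis
        using continuous_on_compose2[OF cont[OF that]] by fastforce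
    qed
    show ?thesis
      unfolding D_def case_prod_beta box_real
      by (intro continuous_intros c continuous_on_compose2[OF cont_\<phi>[of UNIV]]
          continuous_on_compose2[OF cont_\<eta>[of UNIV]]) auto
  qed
  have dJ: "(J has_vector_derivative q \<beta> t - q \<alpha> t) (at t within {r..s})" if t: "t \<in> {r..s}" for t
  proof -
    have "((\<lambda>t. integral (cbox \<alpha> \<beta>) (\<lambda>x. u x t * \<phi> x * \<eta> t)) has_vector_derivative
        integral (cbox \<alpha> \<beta>) (D t)) (at t within {r..s})"
    proof (rule leibniz_rule_vector_derivative[OF _ _ cont_D t])
      fix t x assume t: "t \<in> {r..s}" and x: "x \<in> cbox \<alpha> \<beta>"
      then have xt: "x \<in> {0<..<a}" "t \<in> {0<..<T}"
        using sub by auto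
      have "((\<lambda>t. u x t * \<phi> x * \<eta> t) has_vector_derivative D t x) (at t)"
        unfolding D_def
        by (rule derivative_eq_intros ut[OF xt] \<eta>' refl)+ (simp add: algebra_simps)
      then show "((\<lambda>t. u x t * \<phi> x * \<eta> t) has_vector_derivative D t x) (at t within {r..s})"
        by (rule has_vector_derivative_at_within)
    next
      fix t assume t: "t \<in> {r..s}"
      show "(\<lambda>x. u x t * \<phi> x * \<eta> t) integrable_on cbox \<alpha> \<beta>"
        by (rule integrable_continuous) (auto intro!: continuous_intros slice t cont_\<phi>)
    qed simp
    then show ?thesis
      unfolding J_def using flux[OF t] by simp
  qed
  have "((\<lambda>t. q \<beta> t - q \<alpha> t) has_integral (J s - J r)) {r..s}"
    by (rule fundamental_theorem_of_calculus[OF rs(2) dJ])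
  moreover have "q x integrable_on {r..s}" if "x \<in> {\<alpha>..\<beta>}" for x
  proof (rule integrable_continuous_real)
    have "x \<in> {0<..<a}"
      using that sub by auto
    then show "continuous_on {r..s} (q x)"
      unfolding q_def
      using continuous_on_subset[OF continuous_on_rectangle_slice(2)[OF cont[of u]] sub(2)]
        continuous_on_subset[OF continuous_on_rectangle_slice(2)[OF cont[of ux]] sub(2)]
      by (auto intro!: continuous_intros cont_\<eta>)
  qed
  ultimately have "J s - J r = integral {r..s} (q \<beta>) - integral {r..s} (q \<alpha>)"
    using \<alpha>\<beta> by (simp add: Henstock_Kurzweil_Integration.integral_diff[symmetric] integral_unique)
  moreover have "J t = \<eta> t * integral {\<alpha>..\<beta>} (\<lambda>x. u x t * \<phi> x)" for t
    unfolding J_def by (simp add: mult.commute)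
  ultimately show ?thesis
    by (simp add: q_def[abs_def])
qed

text \<open>
  The two factors that depend on \<open>x\<close> alone come out of the \<open>t\<close>-integral; what remains are
  weighted integrals of \<open>u x\<close> and \<open>ux x\<close>, which converge to those of the traces.
\<close>

lemma flux_integral_tendsto:
  fixes u ux :: "real \<Rightarrow> real \<Rightarrow> complex" and \<phi> \<phi>' \<eta> :: "real \<Rightarrow> complex"
  assumes u: "L1_tendsto u (u b) {r..s} F" and ux: "L1_tendsto ux (ux b) {r..s} F"
    and \<phi>: "(\<phi> \<longlongrightarrow> \<phi> b) F" and \<phi>': "(\<phi>' \<longlongrightarrow> \<phi>' b) F" and \<eta>: "continuous_on {r..s} \<eta>"
  shows "((\<lambda>x. integral {r..s} (\<lambda>t. (ux x t * \<phi> x - u x t * \<phi>' x) * \<eta> t))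
          \<longlongrightarrow> integral {r..s} (\<lambda>t. (ux b t * \<phi> b - u b t * \<phi>' b) * \<eta> t)) F"
proof -
  have split: "integral {r..s} (\<lambda>t. (ux x t * \<phi> x - u x t * \<phi>' x) * \<eta> t)
      = integral {r..s} (\<lambda>t. ux x t * \<eta> t) * \<phi> x - integral {r..s} (\<lambda>t. u x t * \<eta> t) * \<phi>' x"
    if "u x absolutely_integrable_on {r..s}" "ux x absolutely_integrable_on {r..s}" for x
  proof -
    have i: "(\<lambda>t. w x t * \<eta> t) integrable_on {r..s}" if "w x absolutely_integrable_on {r..s}" for w
      using absolutely_integrable_times_continuous[OF that _ _ \<eta>]
      by (intro set_lebesgue_integral_eq_integral(1)) auto
    have "integral {r..s} (\<lambda>t. (ux x t * \<phi> x - u x t * \<phi>' x) * \<eta> t)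
        = integral {r..s} (\<lambda>t. ux x t * \<eta> t * \<phi> x - u x t * \<eta> t * \<phi>' x)"
      by (simp add: algebra_simps)
    also have "\<dots> = integral {r..s} (\<lambda>t. ux x t * \<eta> t * \<phi> x) - integral {r..s} (\<lambda>t. u x t * \<eta> t * \<phi>' x)"
      by (intro Henstock_Kurzweil_Integration.integral_diff integrable_on_mult_left i that)
    finally show ?thesis
      by simp
  qed
  have "((\<lambda>x. integral {r..s} (\<lambda>t. ux x t * \<eta> t) * \<phi> x - integral {r..s} (\<lambda>t. u x t * \<eta> t) * \<phi>' x)
      \<longlongrightarrow> integral {r..s} (\<lambda>t. ux b t * \<eta> t) * \<phi> b - integral {r..s} (\<lambda>t. u b t * \<eta> t) * \<phi>' b) F"
    by (intro tendsto_intros L1_tendsto_integral_times[OF u] L1_tendsto_integral_times[OF ux] \<phi> \<phi>')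
      (auto simp: \<eta>)
  moreover have "\<forall>\<^sub>F x in F. integral {r..s} (\<lambda>t. ux x t * \<eta> t) * \<phi> x - integral {r..s} (\<lambda>t. u x t * \<eta> t) * \<phi>' x
      = integral {r..s} (\<lambda>t. (ux x t * \<phi> x - u x t * \<phi>' x) * \<eta> t)"
    using u ux split unfolding L1_tendsto_def by (auto elim: eventually_elim2)
  ultimately have "((\<lambda>x. integral {r..s} (\<lambda>t. (ux x t * \<phi> x - u x t * \<phi>' x) * \<eta> t))
      \<longlongrightarrow> integral {r..s} (\<lambda>t. ux b t * \<eta> t) * \<phi> b - integral {r..s} (\<lambda>t. u b t * \<eta> t) * \<phi>' b) F"
    by (rule Lim_transform_eventually)
  moreover have "u b absolutely_integrable_on {r..s}" "ux b absolutely_integrable_on {r..s}"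
    using u ux by (auto simp: L1_tendsto_def)
  ultimately show ?thesis
    by (simp add: split)
qed

text \<open>
  The interior identity is pushed to the sides \<open>x = 0\<close> and \<open>x = a\<close>.  It says that the difference
  of the primitive of the density in \<open>x\<close> and the flux integral through the vertical line at \<open>x\<close> is
  constant in \<open>x\<close>; the two one-sided limits of this constant give the identity.  The times \<open>r\<close> and
  \<open>s\<close> must be such that \<open>u\<close> is integrable in \<open>x\<close> up to the sides, which the regularity
  assumptions guarantee only for times close to \<open>0\<close> and to \<open>T\<close>.
\<close>

lemma green_identity_between_times:
  fixes u ux :: "real \<Rightarrow> real \<Rightarrow> complex" and \<phi> \<phi>' :: "real \<Rightarrow> complex" and \<kappa> :: complex
  assumes heat: "heat_equation_on a T u ux" and bv: "has_boundary_values a T u ux" and "0 < a"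
    and \<phi>: "\<And>x. (\<phi> has_vector_derivative \<phi>' x) (at x)"
    and \<phi>': "\<And>x. (\<phi>' has_vector_derivative \<kappa> * \<phi> x) (at x)"
    and rs: "0 < r" "r < s" "s < T"
    and ints: "(\<lambda>x. u x r) absolutely_integrable_on {0<..<a}" "(\<lambda>x. u x s) absolutely_integrable_on {0<..<a}"
  defines "\<eta> \<equiv> \<lambda>t. exp (- \<kappa> * of_real t)"
  shows "\<eta> s * integral {0<..<a} (\<lambda>x. u x s * \<phi> x) - \<eta> r * integral {0<..<a} (\<lambda>x. u x r * \<phi> x)
       = integral {r..s} (\<lambda>t. (ux a t * \<phi> a - u a t * \<phi>' a) * \<eta> t)
       - integral {r..s} (\<lambda>t. (ux 0 t * \<phi> 0 - u 0 t * \<phi>' 0) * \<eta> t)"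
proof -
  have c\<phi>: "isCont \<phi> x" "isCont \<phi>' x" for x
    using \<phi> \<phi>' has_vector_derivative_continuous by blast+
  have c\<eta>: "continuous_on {r..s} \<eta>"
    unfolding \<eta>_def by (intro continuous_intros)
  define Q where "Q x = integral {r..s} (\<lambda>t. (ux x t * \<phi> x - u x t * \<phi>' x) * \<eta> t)" for x
  define \<Phi> where "\<Phi> t x = integral {0..x} (\<lambda>y. u y t * \<phi> y)" for t x
  define E where "E x = \<eta> s * \<Phi> s x - \<eta> r * \<Phi> r x" for x
  have int: "(\<lambda>y. u y t * \<phi> y) integrable_on {0..a}" if "t \<in> {r, s}" for t
  proof -
    have "(\<lambda>y. u y t * \<phi> y) absolutely_integrable_on {0<..<a}"
      using ints that
      by (intro absolutely_integrable_times_continuous[where l = 0 and m = a])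
        (auto intro!: continuous_at_imp_continuous_on c\<phi>)
    then show ?thesis
      using set_lebesgue_integral_eq_integral(1) integrable_on_open_interval_real by blast
  qed
  have cE: "continuous_on {0..a} E"
    unfolding E_def \<Phi>_def by (intro continuous_intros indefinite_integral_continuous_1 int) auto
  have sub: "integral {\<alpha>..\<beta>} (\<lambda>y. u y t * \<phi> y) = \<Phi> t \<beta> - \<Phi> t \<alpha>"
    if "t \<in> {r, s}" "0 < \<alpha>" "\<alpha> \<le> \<beta>" "\<beta> < a" for t \<alpha> \<beta>
    using Henstock_Kurzweil_Integration.integral_combine[of 0 \<alpha> \<beta> "\<lambda>y. u y t * \<phi> y"]
      integrable_subinterval_real[OF int[OF that(1)], of 0 \<beta>] that
    by (simp add: \<Phi>_def algebra_simps)
  have step: "E \<beta> - E \<alpha> = Q \<beta> - Q \<alpha>" if "0 < \<alpha>" "\<alpha> \<le> \<beta>" "\<beta> < a" for \<alpha> \<beta>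
  proof -
    have "\<eta> s * (\<Phi> s \<beta> - \<Phi> s \<alpha>) - \<eta> r * (\<Phi> r \<beta> - \<Phi> r \<alpha>) = Q \<beta> - Q \<alpha>"
      using interior_green_identity[OF heat \<phi> \<phi>' that rs(1) less_imp_le[OF rs(2)] rs(3)]
      by (simp add: sub that Q_def \<eta>_def)
    then show ?thesis
      by (simp add: E_def algebra_simps)
  qed
  define k where "k = E (a / 2) - Q (a / 2)"
  have const: "E x - Q x = k" if "0 < x" "x < a" for x
    using step[of x "a / 2"] step[of "a / 2" x] that \<open>0 < a\<close>
    by (cases "x \<le> a / 2") (auto simp: k_def algebra_simps)
  have "((\<lambda>x. E x - Q x) \<longlongrightarrow> E 0 - Q 0) (at_right 0)"
  proof (rule tendsto_diff)
    show "(E \<longlongrightarrow> E 0) (at_right 0)"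
      using continuous_on_Icc_at_rightD[OF cE \<open>0 < a\<close>] .
    show "(Q \<longlongrightarrow> Q 0) (at_right 0)"
      unfolding Q_def using bv rs c\<phi>
      by (intro flux_integral_tendsto c\<eta>)
        (auto simp: has_boundary_values_def isCont_def intro: tendsto_within_subset)
  qed
  moreover have "\<forall>\<^sub>F x in at_right 0. E x - Q x = k"
    using const \<open>0 < a\<close> by (auto simp: eventually_at_right[of 0 a])
  ultimately have 1: "E 0 - Q 0 = k"
    by (metis tendsto_unique tendsto_eventually trivial_limit_at_right_real)
  have "((\<lambda>x. E x - Q x) \<longlongrightarrow> E a - Q a) (at_left a)"
  proof (rule tendsto_diff)
    show "(E \<longlongrightarrow> E a) (at_left a)"
      using continuous_on_Icc_at_leftD[OF cE \<open>0 < a\<close>] .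
    show "(Q \<longlongrightarrow> Q a) (at_left a)"
      unfolding Q_def using bv rs c\<phi>
      by (intro flux_integral_tendsto c\<eta>)
        (auto simp: has_boundary_values_def isCont_def intro: tendsto_within_subset)
  qed
  moreover have "\<forall>\<^sub>F x in at_left a. E x - Q x = k"
    using const \<open>0 < a\<close> by (auto simp: eventually_at_left[of 0 a])
  ultimately have "E a - Q a = k"
    by (metis tendsto_unique tendsto_eventually trivial_limit_at_left_real)
  with 1 have "E a - E 0 = Q a - Q 0"
    by (simp add: algebra_simps)
  moreover have "E 0 = 0"
    by (simp add: E_def \<Phi>_def)
  ultimately show ?thesis
    by (simp add: E_def \<Phi>_def Q_def integral_open_interval_real)
qed

text \<open>
  If the weight satisfies the Robin condition of the solution, then the unknown data at \<open>x = a\<close>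
  disappear, and the Laplace transforms of the two traces at \<open>x = 0\<close> are linked up to a term that
  carries the factor \<open>exp (- \<kappa> T)\<close>.  The passage to \<open>r = 0\<close> and \<open>s = T\<close> is again a constancy
  argument: the weighted mass \<open>\<eta> t * \<integral> u(x,t) \<phi>(x) dx\<close> plus the flux accumulated at \<open>x = 0\<close> does not
  depend on \<open>t\<close>.
\<close>

lemma lateral_green_identity:
  fixes u ux :: "real \<Rightarrow> real \<Rightarrow> complex" and \<phi> \<phi>' :: "real \<Rightarrow> complex" and \<rho> \<kappa> :: complex
  assumes sol: "heat_robin_solution a T \<rho> u ux" and "0 < a" "0 < T"
    and flux: "ux 0 absolutely_integrable_on {0<..<T}"
    and \<phi>: "\<And>x. (\<phi> has_vector_derivative \<phi>' x) (at x)"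
    and \<phi>': "\<And>x. (\<phi>' has_vector_derivative \<kappa> * \<phi> x) (at x)"
    and robin: "\<phi>' a + \<rho> * \<phi> a = 0"
  defines "\<eta> \<equiv> \<lambda>t. exp (- \<kappa> * of_real t)"
  shows "integral {0<..<T} (\<lambda>t. ux 0 t * \<eta> t) * \<phi> 0 - integral {0<..<T} (\<lambda>t. u 0 t * \<eta> t) * \<phi>' 0
       = - (\<eta> T * integral {0<..<a} (\<lambda>x. u x T * \<phi> x))"
proof -
  have heat: "heat_equation_on a T u ux" and bv: "has_boundary_values a T u ux"
    and robin_u: "\<And>t. t \<in> {0<..<T} \<Longrightarrow> ux a t + \<rho> * u a t = 0"
    and initial: "\<And>x. x \<in> {0<..<a} \<Longrightarrow> u x 0 = 0"
    using sol by (auto simp: heat_robin_solution_def)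
  have trace: "u 0 absolutely_integrable_on {0<..<T}"
    and L0: "L1_tendsto (\<lambda>t x. u x t) (\<lambda>x. u x 0) {0<..<a} (at_right 0)"
    and LT: "L1_tendsto (\<lambda>t x. u x t) (\<lambda>x. u x T) {0<..<a} (at_left T)"
    using bv by (auto simp: has_boundary_values_def)
  have c\<phi>: "continuous_on {0..a} \<phi>"
    using \<phi> by (meson continuous_at_imp_continuous_on has_vector_derivative_continuous)
  have c\<eta>: "continuous_on X \<eta>" for X
    unfolding \<eta>_def by (intro continuous_intros)
  define q where "q t = (ux 0 t * \<phi> 0 - u 0 t * \<phi>' 0) * \<eta> t" for t
  define E where "E t = \<eta> t * integral {0<..<a} (\<lambda>x. u x t * \<phi> x)" for t
  define \<Psi> where "\<Psi> t = integral {0..t} q" for t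
  have i: "(\<lambda>t. w t * \<eta> t) integrable_on {0<..<T}" if "w absolutely_integrable_on {0<..<T}" for w
    by (intro set_lebesgue_integral_eq_integral(1)
        absolutely_integrable_times_continuous[OF that _ _ c\<eta>[of "{0..T}"]]) auto
  have q: "(q has_integral integral {0<..<T} (\<lambda>t. ux 0 t * \<eta> t) * \<phi> 0
      - integral {0<..<T} (\<lambda>t. u 0 t * \<eta> t) * \<phi>' 0) {0<..<T}"
  proof -
    have "((\<lambda>t. ux 0 t * \<eta> t * \<phi> 0 - u 0 t * \<eta> t * \<phi>' 0) has_integral integral {0<..<T} (\<lambda>t. ux 0 t * \<eta> t) * \<phi> 0
        - integral {0<..<T} (\<lambda>t. u 0 t * \<eta> t) * \<phi>' 0) {0<..<T}"
      by (intro has_integral_diff has_integral_mult_left integrable_integral i flux trace)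
    then show ?thesis
      by (simp add: q_def[abs_def] algebra_simps)
  qed
  have int_q: "q integrable_on {0..T}"
    using q integrable_on_open_interval_real by blast
  have c\<Psi>: "continuous_on {0..T} \<Psi>"
    unfolding \<Psi>_def by (rule indefinite_integral_continuous_1[OF int_q])
  \<comment> \<open>The flux through \<open>x = a\<close> vanishes because \<open>u\<close> and \<open>\<phi>\<close> satisfy the same Robin condition.\<close>
  have step: "E s + \<Psi> s = E r + \<Psi> r"
    if "0 < r" "r < s" "s < T" "(\<lambda>x. u x r) absolutely_integrable_on {0<..<a}"
      "(\<lambda>x. u x s) absolutely_integrable_on {0<..<a}" for r s
  proof -
    have "(ux a t * \<phi> a - u a t * \<phi>' a) * \<eta> t = 0" if "t \<in> {r..s}" for t
    proof -
      have "ux a t = - (\<rho> * u a t)" "\<phi>' a = - (\<rho> * \<phi> a)"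
        using robin_u[of t] robin that \<open>0 < r\<close> \<open>s < T\<close> by (auto simp: eq_neg_iff_add_eq_0)
      then show ?thesis
        by (simp add: algebra_simps)
    qed
    then have "integral {r..s} (\<lambda>t. (ux a t * \<phi> a - u a t * \<phi>' a) * \<eta> t) = integral {r..s} (\<lambda>t. 0)"
      by (intro Henstock_Kurzweil_Integration.integral_cong)
    moreover have "integral {r..s} q = \<Psi> s - \<Psi> r"
      using Henstock_Kurzweil_Integration.integral_combine[of 0 r s q]
        integrable_subinterval_real[OF int_q, of 0 s] that
      by (simp add: \<Psi>_def algebra_simps)
    ultimately have "E s - E r = 0 - (\<Psi> s - \<Psi> r)"
      using green_identity_between_times[OF heat bv \<open>0 < a\<close> \<phi> \<phi>' that]
      unfolding E_def q_def \<eta>_def by simp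
    then show ?thesis
      by (simp add: algebra_simps)
  qed
  have lim0: "((\<lambda>r. E r + \<Psi> r) \<longlongrightarrow> 0) (at_right 0)"
  proof -
    have "integral {0<..<a} (\<lambda>x. u x 0 * \<phi> x) = integral {0<..<a} (\<lambda>x. 0)"
      by (intro Henstock_Kurzweil_Integration.integral_cong) (simp add: initial)
    moreover have "((\<lambda>t. integral {0<..<a} (\<lambda>x. u x t * \<phi> x)) \<longlongrightarrow> integral {0<..<a} (\<lambda>x. u x 0 * \<phi> x)) (at_right 0)"
      by (rule L1_tendsto_integral_times[OF L0 _ _ c\<phi>]) auto
    moreover have "(\<eta> \<longlongrightarrow> \<eta> 0) (at_right 0)" "(\<Psi> \<longlongrightarrow> \<Psi> 0) (at_right 0)"
      using continuous_on_Icc_at_rightD[OF c\<eta> \<open>0 < T\<close>] continuous_on_Icc_at_rightD[OF c\<Psi> \<open>0 < T\<close>] .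
    moreover have "\<Psi> 0 = 0"
      by (simp add: \<Psi>_def)
    ultimately show ?thesis
      unfolding E_def by (auto intro!: tendsto_eq_intros)
  qed
  \<comment> \<open>Letting the earlier time tend to \<open>0\<close> identifies the constant, because \<open>u\<close> vanishes initially.\<close>
  have vanish: "E s + \<Psi> s = 0"
    if s: "0 < s" "s < T" "(\<lambda>x. u x s) absolutely_integrable_on {0<..<a}" for s
  proof -
    have "\<forall>\<^sub>F r in at_right 0. (\<lambda>x. u x r) absolutely_integrable_on {0<..<a}"
      using L0 by (simp add: L1_tendsto_def)
    moreover have "\<forall>\<^sub>F r in at_right 0. 0 < r \<and> r < s"
      using s by (auto simp: eventually_at_right[of 0 s])
    ultimately have "\<forall>\<^sub>F r in at_right 0. E r + \<Psi> r = E s + \<Psi> s"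
      by eventually_elim (use step s in auto)
    from tendsto_unique[OF _ tendsto_eventually[OF this] lim0] show ?thesis
      by simp
  qed
  have "((\<lambda>s. E s + \<Psi> s) \<longlongrightarrow> E T + \<Psi> T) (at_left T)"
    unfolding E_def
    using continuous_on_Icc_at_leftD[OF c\<eta> \<open>0 < T\<close>] continuous_on_Icc_at_leftD[OF c\<Psi> \<open>0 < T\<close>]
    by (intro tendsto_intros L1_tendsto_integral_times[OF LT _ _ c\<phi>]) auto
  moreover have "\<forall>\<^sub>F s in at_left T. E s + \<Psi> s = 0"
  proof -
    have "\<forall>\<^sub>F s in at_left T. (\<lambda>x. u x s) absolutely_integrable_on {0<..<a}"
      using LT by (simp add: L1_tendsto_def)
    moreover have "\<forall>\<^sub>F s in at_left T. 0 < s \<and> s < T"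
      using \<open>0 < T\<close> by (auto simp: eventually_at_left[of 0 T])
    ultimately show ?thesis
      by eventually_elim (use vanish in auto)
  qed
  ultimately have "E T + \<Psi> T = 0"
    by (metis tendsto_unique tendsto_eventually trivial_limit_at_left_real)
  moreover have "\<Psi> T = integral {0<..<T} q"
    by (simp add: \<Psi>_def integral_open_interval_real)
  ultimately show ?thesis
    using integral_unique[OF q] by (simp add: E_def eq_neg_iff_add_eq_0 add.commute)
qed

section \<open>The reflected probe\<close>

lemma zeta_facts:
  assumes "c > 0" "\<tau> \<ge> 1 / c\<^sup>2"
  shows "\<tau> > 0" "Re (zeta c \<tau>) = - (c * \<tau>)" "c * \<tau> \<le> norm (zeta c \<tau>)" "Re ((zeta c \<tau>)\<^sup>2) = \<tau>"
proof -
  have "0 < 1 / c\<^sup>2"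
    using assms by simp
  then show pos: "\<tau> > 0"
    using assms by linarith
  show re: "Re (zeta c \<tau>) = - (c * \<tau>)"
    by (simp add: zeta_def)
  show "c * \<tau> \<le> norm (zeta c \<tau>)"
    using abs_Re_le_cmod[of "zeta c \<tau>"] pos assms by (simp add: re)
  show "Re ((zeta c \<tau>)\<^sup>2) = \<tau>"
    by (simp add: zeta_squared[OF assms])
qed

lemma indicator_integral_eq:
  fixes u ux :: "real \<Rightarrow> real \<Rightarrow> complex" and c \<tau> T :: real
  assumes "u 0 absolutely_integrable_on {0<..<T}" "ux 0 absolutely_integrable_on {0<..<T}"
  defines "\<eta> \<equiv> \<lambda>t. exp (- (zeta c \<tau>)\<^sup>2 * of_real t)"
  shows "indicator_integral c T u ux \<tau>
       = integral {0<..<T} (\<lambda>t. ux 0 t * \<eta> t) - zeta c \<tau> * integral {0<..<T} (\<lambda>t. u 0 t * \<eta> t)"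
proof -
  have c\<eta>: "continuous_on {0..T} \<eta>"
    unfolding \<eta>_def by (intro continuous_intros)
  have ai: "(\<lambda>t. w t * \<eta> t) absolutely_integrable_on {0<..<T}"
    if "w absolutely_integrable_on {0<..<T}" for w
    by (rule absolutely_integrable_times_continuous[OF that _ _ c\<eta>]) auto
  have "((\<lambda>x. probe c \<tau> x t) has_vector_derivative zeta c \<tau> * \<eta> t) (at 0)" for t
  proof -
    have "((\<lambda>w. \<eta> t * exp (w * zeta c \<tau>)) has_field_derivative zeta c \<tau> * \<eta> t) (at (of_real 0))"
      by (auto intro!: derivative_eq_intros)
    from has_vector_derivative_real_field[OF this] show ?thesis
      by (simp add: probe_def \<eta>_def)
  qed
  then have vd: "vector_derivative (\<lambda>x. probe c \<tau> x t) (at 0) = zeta c \<tau> * \<eta> t" for t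
    by (rule vector_derivative_at)
  have eq: "- vector_derivative (\<lambda>x. probe c \<tau> x t) (at 0) * u 0 t + ux 0 t * probe c \<tau> 0 t
      = ux 0 t * \<eta> t - zeta c \<tau> * (u 0 t * \<eta> t)" for t
    unfolding vd by (simp add: probe_def \<eta>_def)
  have ai': "(\<lambda>t. ux 0 t * \<eta> t - zeta c \<tau> * (u 0 t * \<eta> t)) absolutely_integrable_on {0<..<T}"
    using ai assms(1,2) by (intro set_integral_diff(1) set_integrable_mult_right)
  have "indicator_integral c T u ux \<tau> = integral {0<..<T} (\<lambda>t. ux 0 t * \<eta> t - zeta c \<tau> * (u 0 t * \<eta> t))"
    unfolding indicator_integral_def eq using set_lebesgue_integral_eq_integral(2)[OF ai'] .
  also have "\<dots> = integral {0<..<T} (\<lambda>t. ux 0 t * \<eta> t) - integral {0<..<T} (\<lambda>t. zeta c \<tau> * (u 0 t * \<eta> t))"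
    using set_lebesgue_integral_eq_integral(1)[OF ai] assms(1,2)
    by (intro Henstock_Kurzweil_Integration.integral_diff integrable_on_mult_right)
  finally show ?thesis
    by simp
qed

text \<open>
  The reflection coefficient of the Robin end: \<open>x \<mapsto> exp (x z) + reflection a \<rho> z * exp (- x z)\<close>
  is the solution of \<open>\<phi>'' = z\<^sup>2 \<phi>\<close> that satisfies \<open>\<phi>' + \<rho> \<phi> = 0\<close> at \<open>x = a\<close> and has incoming
  part \<open>exp (x z)\<close>.
\<close>

definition reflection :: "real \<Rightarrow> complex \<Rightarrow> complex \<Rightarrow> complex" where
  "reflection a \<rho> z = (z + \<rho>) / (z - \<rho>) * exp (2 * of_real a * z)"

text \<open>
  The quotient in the coefficient tends to \<open>1\<close> as \<open>|z|\<close> grows, which leaves the factor \<open>exp (2 a z)\<close>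
  that a wave collects on the way to \<open>x = a\<close> and back.
\<close>

lemma norm_reflection_bounds:
  assumes "2 * norm \<rho> \<le> norm z" "z \<noteq> 0"
  shows "exp (2 * a * Re z) / 3 \<le> norm (reflection a \<rho> z)"
    and "norm (reflection a \<rho> z) \<le> 3 * exp (2 * a * Re z)"
proof -
  have "norm (z + \<rho>) \<le> norm z + norm \<rho>" "norm z - norm \<rho> \<le> norm (z + \<rho>)"
    "norm (z - \<rho>) \<le> norm z + norm \<rho>" "norm z - norm \<rho> \<le> norm (z - \<rho>)"
    using norm_triangle_ineq norm_diff_ineq norm_triangle_ineq4 norm_triangle_ineq2 by auto
  moreover have "0 < norm z"
    using assms by simp
  ultimately have "0 < norm (z - \<rho>)" "norm (z - \<rho>) \<le> 3 * norm (z + \<rho>)" "norm (z + \<rho>) \<le> 3 * norm (z - \<rho>)"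
    using assms(1) by linarith+
  then have "1 / 3 \<le> norm (z + \<rho>) / norm (z - \<rho>)" "norm (z + \<rho>) / norm (z - \<rho>) \<le> 3"
    by (simp_all add: pos_le_divide_eq pos_divide_le_eq)
  note this[THEN mult_right_mono, of "exp (2 * a * Re z)"]
  then show "exp (2 * a * Re z) / 3 \<le> norm (reflection a \<rho> z)"
    and "norm (reflection a \<rho> z) \<le> 3 * exp (2 * a * Re z)"
    by (auto simp: reflection_def norm_mult norm_divide)
qed

text \<open>
  The lateral identity with the reflected wave as weight reads \<open>(1 + K) F - z (1 - K) U = - G\<close>,
  where \<open>F\<close> and \<open>U\<close> are the Laplace transforms of \<open>u\<^sub>x(0,\<cdot>)\<close> and \<open>u(0,\<cdot>)\<close> at \<open>z\<^sup>2\<close>, and \<open>G\<close> is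
  the contribution of the final time.  Eliminating \<open>U\<close> expresses \<open>F - z U\<close>, the indicator integral,
  through the flux transform and the final-time term.
\<close>

lemma reflected_identity:
  fixes u ux :: "real \<Rightarrow> real \<Rightarrow> complex" and z :: complex
  assumes sol: "heat_robin_solution a T \<rho> u ux" and "0 < a" "0 < T"
    and flux: "ux 0 absolutely_integrable_on {0<..<T}" and "z \<noteq> \<rho>"
  defines "\<eta> \<equiv> \<lambda>t. exp (- z\<^sup>2 * of_real t)"
    and "K \<equiv> reflection a \<rho> z"
  shows "(1 - K) * (integral {0<..<T} (\<lambda>t. ux 0 t * \<eta> t) - z * integral {0<..<T} (\<lambda>t. u 0 t * \<eta> t))
       = - (2 * K * integral {0<..<T} (\<lambda>t. ux 0 t * \<eta> t)
          + \<eta> T * integral {0<..<a} (\<lambda>x. u x T * (exp (of_real x * z) + K * exp (- (of_real x * z)))))"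
proof -
  define \<phi> where "\<phi> x = exp (of_real x * z) + K * exp (- (of_real x * z))" for x :: real
  define \<phi>' where "\<phi>' x = z * (exp (of_real x * z) - K * exp (- (of_real x * z)))" for x :: real
  have "(\<phi> has_vector_derivative \<phi>' x) (at x)" for x
  proof -
    have "((\<lambda>w. exp (w * z) + K * exp (- (w * z))) has_field_derivative \<phi>' x) (at (of_real x))"
      unfolding \<phi>'_def by (auto intro!: derivative_eq_intros simp: algebra_simps)
    from has_vector_derivative_real_field[OF this] show ?thesis
      by (simp add: \<phi>_def[abs_def])
  qed
  moreover have "(\<phi>' has_vector_derivative z\<^sup>2 * \<phi> x) (at x)" for x
  proof -
    have "((\<lambda>w. z * (exp (w * z) - K * exp (- (w * z)))) has_field_derivative z\<^sup>2 * \<phi> x) (at (of_real x))"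
      unfolding \<phi>_def by (auto intro!: derivative_eq_intros simp: algebra_simps power2_eq_square)
    from has_vector_derivative_real_field[OF this] show ?thesis
      by (simp add: \<phi>'_def[abs_def])
  qed
  moreover have "\<phi>' a + \<rho> * \<phi> a = 0"
  proof -
    have "exp (2 * of_real a * z) * exp (- (of_real a * z)) = exp (of_real a * z)"
      by (simp add: exp_add[symmetric] algebra_simps)
    then have "K * exp (- (of_real a * z)) = (z + \<rho>) / (z - \<rho>) * exp (of_real a * z)"
      by (simp add: K_def reflection_def)
    then show ?thesis
      using \<open>z \<noteq> \<rho>\<close> by (simp add: \<phi>_def \<phi>'_def field_simps)
  qed
  ultimately have "integral {0<..<T} (\<lambda>t. ux 0 t * \<eta> t) * \<phi> 0 - integral {0<..<T} (\<lambda>t. u 0 t * \<eta> t) * \<phi>' 0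
      = - (\<eta> T * integral {0<..<a} (\<lambda>x. u x T * \<phi> x))"
    unfolding \<eta>_def by (rule lateral_green_identity[OF sol \<open>0 < a\<close> \<open>0 < T\<close> flux])
  then show ?thesis
    by (simp add: \<phi>_def \<phi>'_def algebra_simps)
qed

section \<open>The exponential rate\<close>

text \<open>
  Powers of \<open>\<tau>\<close> contribute \<open>O(ln \<tau>)\<close> to the logarithm, and a term decaying at a faster
  exponential rate \<open>q > p\<close> is eventually absorbed by half of the lower main term and by a multiple
  of the upper one.
\<close>

lemma ln_over_tendsto_exponential_rate:
  fixes f :: "real \<Rightarrow> real"
  assumes "A1 > 0" "A2 > 0" "p < q"
    and lower: "\<forall>\<^sub>F \<tau> in at_top. A1 * \<tau> powr \<mu>1 * exp (- p * \<tau>) - B * exp (- q * \<tau>) \<le> f \<tau>"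
    and upper: "\<forall>\<^sub>F \<tau> in at_top. f \<tau> \<le> A2 * \<tau> powr \<mu>2 * exp (- p * \<tau>) + B * exp (- q * \<tau>)"
  shows "((\<lambda>\<tau>. ln (f \<tau>) / \<tau>) \<longlongrightarrow> - p) at_top"
proof -
  have negligible: "\<forall>\<^sub>F \<tau> in at_top. B * exp (- q * \<tau>) \<le> A * \<tau> powr \<mu> * exp (- p * \<tau>)"
    if "A > 0" for A \<mu> :: real
  proof -
    define d where "d = q - p"
    have "d > 0"
      using \<open>p < q\<close> by (simp add: d_def)
    have "((\<lambda>\<tau>. B * (exp (- d * \<tau>) / \<tau> powr \<mu>)) \<longlongrightarrow> B * 0) at_top"
      using \<open>d > 0\<close> by (intro tendsto_mult tendsto_const) real_asymp
    then have "\<forall>\<^sub>F \<tau> in at_top. B * (exp (- d * \<tau>) / \<tau> powr \<mu>) < A"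
      using \<open>A > 0\<close> by (intro order_tendstoD) auto
    then show ?thesis
      using eventually_gt_at_top[of 0]
    proof eventually_elim
      case (elim \<tau>)
      then have "B * exp (- d * \<tau>) * exp (- p * \<tau>) \<le> A * \<tau> powr \<mu> * exp (- p * \<tau>)"
        by (intro mult_right_mono) (auto simp: field_simps)
      also have "B * exp (- d * \<tau>) * exp (- p * \<tau>) = B * exp (- q * \<tau>)"
        by (simp add: d_def exp_add[symmetric] algebra_simps)
      finally show ?case .
    qed
  qed
  have rate: "((\<lambda>\<tau>. ln (A * \<tau> powr \<mu> * exp (- p * \<tau>)) / \<tau>) \<longlongrightarrow> - p) at_top"
    if "A > 0" for A \<mu> :: real
  proof (rule Lim_transform_eventually)
    have "((\<lambda>\<tau>. ln A / \<tau> + \<mu> * (ln \<tau> / \<tau>) - p) \<longlongrightarrow> 0 + \<mu> * 0 - p) at_top"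
      by (intro tendsto_intros) real_asymp+
    then show "((\<lambda>\<tau>. ln A / \<tau> + \<mu> * (ln \<tau> / \<tau>) - p) \<longlongrightarrow> - p) at_top"
      by simp
    show "\<forall>\<^sub>F \<tau> in at_top. ln A / \<tau> + \<mu> * (ln \<tau> / \<tau>) - p = ln (A * \<tau> powr \<mu> * exp (- p * \<tau>)) / \<tau>"
      using eventually_gt_at_top[of 0]
      by eventually_elim (use \<open>A > 0\<close> in \<open>simp add: ln_mult ln_powr field_simps\<close>)
  qed
  have low: "\<forall>\<^sub>F \<tau> in at_top. A1 / 2 * \<tau> powr \<mu>1 * exp (- p * \<tau>) \<le> f \<tau>"
    using lower negligible[OF half_gt_zero[OF \<open>A1 > 0\<close>], of \<mu>1]
    by eventually_elim (simp add: algebra_simps)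
  have up: "\<forall>\<^sub>F \<tau> in at_top. f \<tau> \<le> (A2 + 1) * \<tau> powr \<mu>2 * exp (- p * \<tau>)"
    using upper negligible[OF zero_less_one, of \<mu>2]
    by eventually_elim (simp add: algebra_simps)
  show ?thesis
  proof (rule tendsto_sandwich)
    show "((\<lambda>\<tau>. ln (A1 / 2 * \<tau> powr \<mu>1 * exp (- p * \<tau>)) / \<tau>) \<longlongrightarrow> - p) at_top"
      "((\<lambda>\<tau>. ln ((A2 + 1) * \<tau> powr \<mu>2 * exp (- p * \<tau>)) / \<tau>) \<longlongrightarrow> - p) at_top"
      using rate[of "A1 / 2" \<mu>1] rate[of "A2 + 1" \<mu>2] \<open>A1 > 0\<close> \<open>A2 > 0\<close> by auto
    show "\<forall>\<^sub>F \<tau> in at_top. ln (A1 / 2 * \<tau> powr \<mu>1 * exp (- p * \<tau>)) / \<tau> \<le> ln (f \<tau>) / \<tau>"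
      using low eventually_gt_at_top[of 0]
    proof eventually_elim
      case (elim \<tau>)
      moreover have "0 < A1 / 2 * \<tau> powr \<mu>1 * exp (- p * \<tau>)"
        using elim \<open>A1 > 0\<close> by simp
      ultimately show ?case
        by (intro divide_right_mono ln_mono) auto
    qed
    show "\<forall>\<^sub>F \<tau> in at_top. ln (f \<tau>) / \<tau> \<le> ln ((A2 + 1) * \<tau> powr \<mu>2 * exp (- p * \<tau>)) / \<tau>"
      using low up eventually_gt_at_top[of 0]
    proof eventually_elim
      case (elim \<tau>)
      moreover have "0 < A1 / 2 * \<tau> powr \<mu>1 * exp (- p * \<tau>)"
        using elim \<open>A1 > 0\<close> by simp
      ultimately show ?case
        by (intro divide_right_mono ln_mono) auto
    qed
  qed
qed

theorem theorem4p1: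
  fixes a T M c :: real and \<rho> :: complex and u ux :: "real \<Rightarrow> real \<Rightarrow> complex"
  assumes "a > 0" and "T > 0"
    and "heat_robin_solution a T \<rho> u ux"
    and "M > 0" and "M \<ge> 2 * a"
    and "c > 0" and "M * c < T"
    and "condition_c c T (ux 0)"
  shows "((\<lambda>\<tau>. ln (norm (indicator_integral c T u ux \<tau>)) / \<tau>) \<longlongrightarrow> - 2 * c * a) at_top"
proof -
  define F where "F \<tau> = integral {0<..<T} (\<lambda>t. ux 0 t * exp (- (zeta c \<tau>)\<^sup>2 * of_real t))" for \<tau>
  define I where "I \<tau> = indicator_integral c T u ux \<tau>" for \<tau>
  have flux: "ux 0 absolutely_integrable_on {0<..<T}"
    using assms(8) by (simp add: condition_c_def)
  have trace: "u 0 absolutely_integrable_on {0<..<T}"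
    and final: "(\<lambda>x. u x T) absolutely_integrable_on {0<..<a}"
    using assms(3) by (auto simp: heat_robin_solution_def has_boundary_values_def L1_tendsto_def)
  have F_eq: "(LINT t:{0<..<T}|lebesgue. ux 0 t * exp (- (zeta c \<tau>)\<^sup>2 * of_real t)) = F \<tau>" for \<tau>
    unfolding F_def
    by (intro set_lebesgue_integral_eq_integral(2)
        absolutely_integrable_times_continuous[OF flux, of 0 T])
      (auto intro!: continuous_intros)
  obtain C1 C2 \<tau>0 \<mu>1 \<mu>2 where C: "C1 > 0" "C2 > 0" "\<tau>0 \<ge> 1 / c\<^sup>2"
    and F_bounds: "\<And>\<tau>. \<tau> \<ge> \<tau>0 \<Longrightarrow> C1 * \<tau> powr \<mu>1 \<le> norm (F \<tau>) \<and> norm (F \<tau>) \<le> C2 * \<tau> powr \<mu>2"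
    using assms(8) unfolding condition_c_def F_eq by blast
  define N where "N = (LINT x:{0<..<a}|lebesgue. norm (u x T))"
  have N: "N \<ge> 0"
    unfolding N_def set_lebesgue_integral_def by (intro integral_nonneg_AE) auto
  define p where "p = 2 * c * a"
  \<comment> \<open>The condition on \<open>M\<close> says that the observation lasts longer than the return trip of length \<open>2 a\<close>
      at speed \<open>1 / c\<close>,
      so that the final-time term, of rate \<open>T\<close>, is negligible.\<close>
  have "p < T"
  proof -
    have "2 * a * c \<le> M * c"
      using assms by (intro mult_right_mono) auto
    then show ?thesis
      using \<open>M * c < T\<close> by (simp add: p_def mult.commute mult.left_commute)
  qed
  \<comment> \<open>From here on \<open>2 |\<rho>| \<le> |z|\<close> and the reflection coefficient is at most \<open>1 / 2\<close>.\<close>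
  have ev: "\<forall>\<^sub>F \<tau> in at_top. \<tau> \<ge> \<tau>0 \<and> \<tau> > 0 \<and> 2 * norm \<rho> \<le> c * \<tau> \<and> 3 * exp (- p * \<tau>) \<le> 1 / 2"
  proof -
    have "p > 0"
      using assms by (simp add: p_def)
    then have "\<forall>\<^sub>F \<tau> in at_top. 3 * exp (- p * \<tau>) \<le> 1 / 2"
      by real_asymp
    moreover have "\<forall>\<^sub>F \<tau> in at_top. 2 * norm \<rho> \<le> c * \<tau>"
      using eventually_ge_at_top[of "2 * norm \<rho> / c"]
      by eventually_elim (use \<open>c > 0\<close> in \<open>simp add: field_simps\<close>)
    ultimately show ?thesis
      using eventually_ge_at_top[of \<tau>0] eventually_gt_at_top[of 0] by eventually_elim auto
  qed
  have bounds: "4 / 9 * C1 * \<tau> powr \<mu>1 * exp (- p * \<tau>) - 8 * N * exp (- T * \<tau>) \<le> norm (I \<tau>)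
      \<and> norm (I \<tau>) \<le> 12 * C2 * \<tau> powr \<mu>2 * exp (- p * \<tau>) + 8 * N * exp (- T * \<tau>)"
    if \<tau>: "\<tau> \<ge> \<tau>0" "\<tau> > 0" "2 * norm \<rho> \<le> c * \<tau>" "3 * exp (- p * \<tau>) \<le> 1 / 2" for \<tau>
  proof -
    define z where "z = zeta c \<tau>"
    define K where "K = reflection a \<rho> z"
    define \<phi> where "\<phi> x = exp (of_real x * z) + K * exp (- (of_real x * z))" for x :: real
    define G where "G = exp (- z\<^sup>2 * of_real T) * integral {0<..<a} (\<lambda>x. u x T * \<phi> x)"
    have "\<tau> \<ge> 1 / c\<^sup>2"
      using C(3) \<tau>(1) by linarith
    note zeta = zeta_facts[OF \<open>c > 0\<close> this, folded z_def]
    have "0 < c * \<tau>"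
      using \<open>c > 0\<close> \<tau>(2) by simp
    then have z: "2 * norm \<rho> \<le> norm z" "z \<noteq> 0" "z \<noteq> \<rho>"
      using zeta(3) \<tau>(3) by auto
    have K: "exp (- p * \<tau>) / 3 \<le> norm K" "norm K \<le> 3 * exp (- p * \<tau>)"
      using norm_reflection_bounds[OF z(1,2), of a] by (simp_all add: K_def zeta(2) p_def ac_simps)
    have "norm G \<le> exp (- T * \<tau>) * (4 * N)"
    proof -
      \<comment> \<open>The reflected part grows like \<open>exp (c \<tau> x)\<close>, but it starts from a size of order
          \<open>exp (- 2 a c \<tau>)\<close>, so it stays bounded up to \<open>x = a\<close>.\<close>
      have "norm (\<phi> x) \<le> 4" if "x \<in> {0<..<a}" for x
      proof -
        have "norm (\<phi> x) \<le> exp (- (c * \<tau> * x)) + norm K * exp (c * \<tau> * x)"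
          using norm_triangle_ineq[of "exp (of_real x * z)" "K * exp (- (of_real x * z))"]
          by (simp add: \<phi>_def norm_mult zeta(2) ac_simps)
        also have "norm K * exp (c * \<tau> * x) \<le> 3 * exp (- p * \<tau>) * exp (c * \<tau> * x)"
          using K(2) by (intro mult_right_mono) auto
        also have "\<dots> = 3 * exp (c * \<tau> * (x - 2 * a))"
          by (simp add: exp_add[symmetric] p_def algebra_simps)
        also have "\<dots> \<le> 3 * 1"
          using \<open>0 < c * \<tau>\<close> that by (simp add: mult_le_0_iff)
        also have "exp (- (c * \<tau> * x)) \<le> 1"
          using \<open>0 < c * \<tau>\<close> that by simp
        finally show ?thesis by simp
      qed
      moreover have "continuous_on {0..a} \<phi>"
        unfolding \<phi>_def by (intro continuous_intros)
      ultimately have "norm (integral {0<..<a} (\<lambda>x. u x T * \<phi> x)) \<le> 4 * N"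
        unfolding N_def by (intro norm_integral_times_le[OF final, where l = 0 and m = a]) auto
      moreover have "norm (exp (- z\<^sup>2 * of_real T)) = exp (- T * \<tau>)"
        by (simp add: zeta(4))
      ultimately show ?thesis
        unfolding G_def norm_mult by (metis exp_ge_zero mult_left_mono)
    qed
    have "(1 - K) * I \<tau> = - (2 * K * F \<tau> + G)"
      using reflected_identity[OF assms(3,1,2) flux z(3)]
      by (simp add: I_def indicator_integral_eq[where u = u and ux = ux, OF trace flux] F_def G_def \<phi>_def K_def z_def)
    then have norm_I: "norm (1 - K) * norm (I \<tau>) = norm (2 * K * F \<tau> + G)"
      by (metis norm_minus_cancel norm_mult)
    have 1: "1 / 2 \<le> norm (1 - K)" "norm (1 - K) \<le> 3 / 2"
      using norm_triangle_ineq2[of 1 K] norm_triangle_ineq4[of 1 K] K(2) \<tau>(4) by auto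
    have F: "C1 * \<tau> powr \<mu>1 \<le> norm (F \<tau>)" "norm (F \<tau>) \<le> C2 * \<tau> powr \<mu>2"
      using F_bounds[OF \<tau>(1)] by auto
    have KF: "exp (- p * \<tau>) / 3 * (C1 * \<tau> powr \<mu>1) \<le> norm K * norm (F \<tau>)"
        "norm K * norm (F \<tau>) \<le> 3 * exp (- p * \<tau>) * (C2 * \<tau> powr \<mu>2)"
      using mult_mono[OF K(1) F(1)] mult_mono[OF K(2) F(2)] C by simp_all
    have "2 * (norm K * norm (F \<tau>)) - norm G \<le> norm (2 * K * F \<tau> + G)"
      "norm (2 * K * F \<tau> + G) \<le> 2 * (norm K * norm (F \<tau>)) + norm G"
      using norm_diff_ineq[of "2 * K * F \<tau>" G] norm_triangle_ineq[of "2 * K * F \<tau>" G]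
      by (simp_all add: norm_mult)
    moreover have "1 / 2 * norm (I \<tau>) \<le> norm (1 - K) * norm (I \<tau>)"
      "norm (1 - K) * norm (I \<tau>) \<le> 3 / 2 * norm (I \<tau>)"
      by (intro mult_right_mono 1 norm_ge_zero)+
    \<comment> \<open>The factors \<open>2 / 3\<close> and \<open>2\<close> from \<open>1 - K\<close> meet the factor \<open>2\<close> of the main term and the
        factors \<open>1 / 3\<close> and \<open>3\<close> of the reflection bounds.\<close>
    ultimately show ?thesis
      using KF \<open>norm G \<le> _\<close> norm_I mult_nonneg_nonneg[OF N, of "exp (- T * \<tau>)"]
      by (simp add: algebra_simps)
  qed
  have "((\<lambda>\<tau>. ln (norm (I \<tau>)) / \<tau>) \<longlongrightarrow> - p) at_top"
  proof (rule ln_over_tendsto_exponential_rate[OF _ _ \<open>p < T\<close>])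
    show "\<forall>\<^sub>F \<tau> in at_top. 4 / 9 * C1 * \<tau> powr \<mu>1 * exp (- p * \<tau>) - 8 * N * exp (- T * \<tau>) \<le> norm (I \<tau>)"
      "\<forall>\<^sub>F \<tau> in at_top. norm (I \<tau>) \<le> 12 * C2 * \<tau> powr \<mu>2 * exp (- p * \<tau>) + 8 * N * exp (- T * \<tau>)"
      using ev by (auto elim!: eventually_mono simp del: mult_minus_left dest!: bounds)
  qed (use C in auto)
  then show ?thesis
    by (simp add: I_def p_def)
qed

end
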